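(* Let $\gamma$ be a smooth strictly h-convex closed curve in $\mathbb{H}^2$ enclosing a domain $\Omega$, regarded as a graph $\gamma=\{(\rho(\theta),\theta):\theta\in\mathbb{S}^1\}$ over $\mathbb{S}^1$. Then there exist a constant $C=C(\rho,\max_\gamma|\rho_\theta|,\min_\gamma\kappa)$ and a geodesic circle $\gamma_{\mathbb{H}}$ such that $$\mathrm{dist}(\gamma,\gamma_{\mathbb{H}})\le C\,f\left[\int_\gamma(\Phi-u)(\kappa-1)\,\mathrm{d}s+(L[\gamma]-A[\gamma])-\frac{1}{2\pi}\bigl(L[\gamma]-A[\gamma]\bigr)^2\right],$$ where $f(s)=s^{1/2}+s^{1/6}$ for $s\ge0$, and $\mathrm{dist}$ denotes the Hausdorff distance.
   Context: The hyperbolic plane $\mathbb{H}^2=[0,\infty)\times\mathbb{S}^1$ carries the metric $\overline g=\mathrm{d}r^2+\phi^2(r)g_{\mathbb{S}^1}$ with $\phi(r)=\sinh r$; the origin is the point $r=0$; points are written $(r,\theta)$ in these polar coordinates, and $\rho:\mathbb{S}^1\to(0,\infty)$ is the radial distance function of the graph. Put $\Phi(r)=\cosh r-1$ and $V=\overline\nabla\Phi=\phi(r)\partial_r$. For a closed curve $\gamma$ bounding a domain $\Omega$, $\nu$ is the unit outward normal, $\kappa$ the geodesic curvature with respect to $\nu$ (so $\overline\nabla_TT=-\kappa\nu$ for the unit tangent $T$), $u=\langle V,\nu\rangle$ the support function, $s$ (as integration variable in $\mathrm{d}s$) arc length, $L[\gamma]$ the length of $\gamma$ and $A[\gamma]$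 the area of $\Omega$. The curve is strictly h-convex if $\kappa>1$ everywhere. The Hausdorff distance of compact sets $K,L$ is $\mathrm{dist}(K,L)=\inf\{\delta>0:K\subset B_\delta(L)\text{ and }L\subset B_\delta(K)\}$. *)

theory Defs
  imports "HOL-Analysis.Analysis"
begin

text \<open>
  A point of the hyperbolic plane is written as a complex number: the point with polar coordinates
  \<open>(r, \<theta>)\<close> is \<open>rcis r \<theta>\<close>. This collapses \<open>r = 0\<close> to the origin and gives the plane its usual
  topology; the Euclidean metric of the complex numbers plays no role. Polar coordinates and
  components of tangent vectors with respect to the frame \<open>\<partial>\<^sub>r, \<partial>\<^sub>\<theta>\<close> are elements of
  \<open>real^2\<close>.
\<close>

definition hyp_point :: "real^2 \<Rightarrow> complex" where
  "hyp_point p = rcis (p $ 1) (p $ 2)"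

definition phi :: "real \<Rightarrow> real" where
  "phi r = sinh r"

definition Phi :: "real \<Rightarrow> real" where
  "Phi r = cosh r - 1"

definition hyp_metric :: "real^2 \<Rightarrow> real^2^2" where
  "hyp_metric p = vector [vector [1, 0], vector [0, (phi (p $ 1))\<^sup>2]]"

definition hyp_inner :: "real^2 \<Rightarrow> real^2 \<Rightarrow> real^2 \<Rightarrow> real" where
  "hyp_inner p v w = v \<bullet> (hyp_metric p *v w)"

section \<open>Length, distance, geodesic circles, area\<close>

definition speed :: "(real \<Rightarrow> real^2) \<Rightarrow> real \<Rightarrow> real" where
  "speed c t = sqrt (hyp_inner (c t) (vector_derivative c (at t)) (vector_derivative c (at t)))"

definition line_int :: "(real \<Rightarrow> real) \<Rightarrow> (real \<Rightarrow> real^2) \<Rightarrow> real \<Rightarrow> real \<Rightarrow> real" where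
  "line_int F c a b = integral {a..b} (\<lambda>t. F t * speed c t)"

definition curve_length :: "(real \<Rightarrow> real^2) \<Rightarrow> real \<Rightarrow> real \<Rightarrow> real" where
  "curve_length c a b = line_int (\<lambda>t. 1) c a b"

text \<open>
  The Riemannian distance. Paths are given in polar coordinates with \<open>r \<ge> 0\<close>; they may pass
  through the origin, and while \<open>r = 0\<close> the angle may change at no cost since \<open>phi 0 = 0\<close>.
  The velocity may vanish, so that corners are allowed and nothing is lost by taking paths that
  are \<open>C\<^sup>1\<close> rather than piecewise \<open>C\<^sup>1\<close>. (The library's piecewise \<open>C\<^sup>1\<close> paths may
  have unbounded speed near a breakpoint, where the integral need not exist.)
\<close>

definition hyp_dist :: "complex \<Rightarrow> complex \<Rightarrow> real" where
  "hyp_dist x y = Inf {curve_length c 0 1 | c.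
     c C1_differentiable_on {0..1} \<and> (\<forall>t\<in>{0..1}. c t $ 1 \<ge> 0) \<and>
     hyp_point (c 0) = x \<and> hyp_point (c 1) = y}"

definition geodesic_circle :: "complex \<Rightarrow> real \<Rightarrow> complex set" where
  "geodesic_circle x R = {y. hyp_dist x y = R}"

definition hyp_nhd :: "real \<Rightarrow> complex set \<Rightarrow> complex set" where
  "hyp_nhd \<delta> K = {x. \<exists>y\<in>K. hyp_dist x y < \<delta>}"

definition hausdorff_dist :: "complex set \<Rightarrow> complex set \<Rightarrow> real" where
  "hausdorff_dist K L = Inf {\<delta>. \<delta> > 0 \<and> K \<subseteq> hyp_nhd \<delta> L \<and> L \<subseteq> hyp_nhd \<delta> K}"

text \<open>
  The Riemannian area: the volume density \<open>sqrt (det g)\<close> is integrated in polar coordinates,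
  which cover everything but the origin.
\<close>

definition hyp_area :: "complex set \<Rightarrow> real" where
  "hyp_area S =
     (LINT (r, \<theta>) : {(r, \<theta>). 0 < r \<and> 0 \<le> \<theta> \<and> \<theta> < 2 * pi \<and> hyp_point (vector [r, \<theta>]) \<in> S} | lborel.
        sqrt (det (hyp_metric (vector [r, \<theta>]))))"

section \<open>The Levi-Civita connection\<close>

definition partial_deriv :: "2 \<Rightarrow> (real^2 \<Rightarrow> real) \<Rightarrow> real^2 \<Rightarrow> real" where
  "partial_deriv i f p = deriv (\<lambda>t. f (p + t *\<^sub>R axis i 1)) 0"

text \<open>\<open>christoffel p k i j\<close> is \<open>\<Gamma>\<^sup>k\<^sub>i\<^sub>j\<close> at \<open>p\<close>.\<close>

definition christoffel :: "real^2 \<Rightarrow> 2 \<Rightarrow> 2 \<Rightarrow> 2 \<Rightarrow> real" where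
  "christoffel p k i j = (1 / 2) * (\<Sum>l\<in>UNIV. matrix_inv (hyp_metric p) $ k $ l *
     (partial_deriv i (\<lambda>q. hyp_metric q $ j $ l) p
      + partial_deriv j (\<lambda>q. hyp_metric q $ i $ l) p
      - partial_deriv l (\<lambda>q. hyp_metric q $ i $ j) p))"

text \<open>The covariant derivative of a vector field \<open>X\<close> along a curve \<open>c\<close>.\<close>

definition cov_deriv :: "(real \<Rightarrow> real^2) \<Rightarrow> (real \<Rightarrow> real^2) \<Rightarrow> real \<Rightarrow> real^2" where
  "cov_deriv c X t = (\<chi> k. vector_derivative X (at t) $ k +
     (\<Sum>i\<in>UNIV. \<Sum>j\<in>UNIV. christoffel (c t) k i j * vector_derivative c (at t) $ i * X t $ j))"

section \<open>Radial graphs\<close>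

definition smooth :: "(real \<Rightarrow> real) \<Rightarrow> bool" where
  "smooth f \<longleftrightarrow> (\<forall>n x. (deriv ^^ n) f differentiable (at x))"

text \<open>
  The radial function is a \<open>2\<pi>\<close>-periodic function of the angle; \<open>graph_coords \<rho>\<close> is the curve
  in polar coordinates, \<open>graph_set \<rho>\<close> is its image in the plane, \<open>graph_domain \<rho>\<close> the domain it
  encloses.
\<close>

definition radial_function :: "(real \<Rightarrow> real) \<Rightarrow> bool" where
  "radial_function \<rho> \<longleftrightarrow> smooth \<rho> \<and> (\<forall>\<theta>. \<rho> (\<theta> + 2 * pi) = \<rho> \<theta>) \<and> (\<forall>\<theta>. \<rho> \<theta> > 0)"

definition graph_coords :: "(real \<Rightarrow> real) \<Rightarrow> real \<Rightarrow> real^2" where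
  "graph_coords \<rho> \<theta> = vector [\<rho> \<theta>, \<theta>]"

definition graph_set :: "(real \<Rightarrow> real) \<Rightarrow> complex set" where
  "graph_set \<rho> = range (\<lambda>\<theta>. hyp_point (graph_coords \<rho> \<theta>))"

definition graph_domain :: "(real \<Rightarrow> real) \<Rightarrow> complex set" where
  "graph_domain \<rho> = inside (graph_set \<rho>)"

definition graph_int :: "(real \<Rightarrow> real) \<Rightarrow> (real \<Rightarrow> real) \<Rightarrow> real" where
  "graph_int \<rho> F = line_int F (graph_coords \<rho>) 0 (2 * pi)"

definition graph_length :: "(real \<Rightarrow> real) \<Rightarrow> real" where
  "graph_length \<rho> = curve_length (graph_coords \<rho>) 0 (2 * pi)"

definition graph_area :: "(real \<Rightarrow> real) \<Rightarrow> real" where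
  "graph_area \<rho> = hyp_area (graph_domain \<rho>)"

definition unit_tangent :: "(real \<Rightarrow> real) \<Rightarrow> real \<Rightarrow> real^2" where
  "unit_tangent \<rho> \<theta> =
     (1 / speed (graph_coords \<rho>) \<theta>) *\<^sub>R vector_derivative (graph_coords \<rho>) (at \<theta>)"

text \<open>For a radial graph a normal vector is outward iff its \<open>\<partial>\<^sub>r\<close> component is positive.\<close>

definition unit_normal :: "(real \<Rightarrow> real) \<Rightarrow> real \<Rightarrow> real^2" where
  "unit_normal \<rho> \<theta> = (THE n.
     hyp_inner (graph_coords \<rho> \<theta>) n (unit_tangent \<rho> \<theta>) = 0 \<and>
     hyp_inner (graph_coords \<rho> \<theta>) n n = 1 \<and> n $ 1 > 0)"

text \<open>
  By definition \<open>\<nabla>\<^sub>T T = - \<kappa> \<nu>\<close>. The derivative with respect to arc length is the derivative with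
  respect to the angle divided by the speed.
\<close>

definition curvature :: "(real \<Rightarrow> real) \<Rightarrow> real \<Rightarrow> real" where
  "curvature \<rho> \<theta> = - hyp_inner (graph_coords \<rho> \<theta>)
     ((1 / speed (graph_coords \<rho>) \<theta>) *\<^sub>R cov_deriv (graph_coords \<rho>) (unit_tangent \<rho>) \<theta>)
     (unit_normal \<rho> \<theta>)"

definition strictly_h_convex :: "(real \<Rightarrow> real) \<Rightarrow> bool" where
  "strictly_h_convex \<rho> \<longleftrightarrow> (\<forall>\<theta>. curvature \<rho> \<theta> > 1)"

definition V_field :: "real^2 \<Rightarrow> real^2" where
  "V_field p = vector [phi (p $ 1), 0]"

definition support :: "(real \<Rightarrow> real) \<Rightarrow> real \<Rightarrow> real" where
  "support \<rho> \<theta> =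
     hyp_inner (graph_coords \<rho> \<theta>) (V_field (graph_coords \<rho> \<theta>)) (unit_normal \<rho> \<theta>)"

definition stab_fun :: "real \<Rightarrow> real" where
  "stab_fun s = s powr (1 / 2) + s powr (1 / 6)"

end

theory Submission
  imports Defs
begin

text \<open>
  Work in the hyperboloid model and write \<open>X\<close> for the position vector of the curve and \<open>\<nu>\<close> for its
  normal. The vector \<open>X - \<nu>\<close> is null; its time component is \<open>w = cosh \<rho> - u = 1 + \<Phi> - u\<close>, and its
  direction at infinity, given by an angle \<open>\<psi>\<close>, is the horospherical Gauss map. Since
  \<open>(X - \<nu>)' = (1 - \<kappa>) T\<close> along the curve, \<open>d\<psi> = (\<kappa> - 1) / w ds\<close>. Hence for an h-convex curve \<open>\<psi>\<close> is
  increasing, and it makes exactly one turn.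

  By Gauss-Bonnet, \<open>\<integral> (\<kappa> - 1) ds = 2 \<pi> - (L - A)\<close>. Substituting this in the deficit
  \<open>Q = \<integral> (\<Phi> - u) (\<kappa> - 1) ds + (L - A) - (L - A)\<^sup>2 / (2 \<pi>)\<close> gives
  \<open>Q = \<integral> w\<^sup>2 d\<psi> - (\<integral> w d\<psi>)\<^sup>2 / (2 \<pi>) = \<integral> (w - a)\<^sup>2 d\<psi>\<close>, where \<open>a\<close> is the mean of \<open>w\<close> with
  respect to \<open>\<psi>\<close>: the deficit is a variance (\<open>has_integral_variance\<close>).

  Let \<open>m\<close> and \<open>M\<close> be the minimum and the maximum of \<open>\<rho>\<close>. The function \<open>w\<close> is Lipschitz in \<open>\<psi>\<close>, with
  constant \<open>K = cosh M * sinh M\<close>. Integrating the derivative of \<open>(w - a)\<^sup>3\<close> between two points shows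
  that its values there differ by at most \<open>3 K Q\<close> (\<open>cube_deviation_le\<close>). Where \<open>\<rho>\<close> is extremal,
  \<open>w = exp (- \<rho>)\<close>. Therefore \<open>(exp (- m) - exp (- M))\<^sup>3 \<le> 12 K Q\<close>, which bounds \<open>M - m\<close>
  by a multiple of \<open>Q powr (1 / 3)\<close>, hence of \<open>stab_fun Q\<close> (\<open>oscillation_le\<close>). The circle about the
  origin with radius \<open>M\<close> has Hausdorff distance at most \<open>M - m\<close> from the curve, because the
  hyperbolic distance of two points on a ray from the origin is the difference of their radii.
\<close>

section \<open>Vectors with two components\<close>

lemma has_vector_derivative_vec_nth:
  assumes "(f has_vector_derivative D) F"
  shows "((\<lambda>t. f t $ i) has_vector_derivative D $ i) F"
  by (rule bounded_linear.has_vector_derivative[OF bounded_linear_vec_nth assms])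

lemma has_vector_derivative_vector_2:
  fixes f g :: "real \<Rightarrow> real"
  assumes "(f has_real_derivative f') F" "(g has_real_derivative g') F"
  shows "((\<lambda>t. vector [f t, g t] :: real^2) has_vector_derivative vector [f', g']) F"
proof -
  have eq: "vector [a, b] = a *\<^sub>R axis 1 1 + b *\<^sub>R (axis 2 1 :: real^2)" for a b :: real
    by (simp add: vec_eq_iff forall_2 axis_def)
  show ?thesis
    unfolding eq has_vector_derivative_def using assms[unfolded has_field_derivative_def]
    by (auto intro!: derivative_eq_intros simp: fun_eq_iff algebra_simps)
qed

section \<open>Distance along rays and Hausdorff distance to a circle\<close>

lemma hyp_inner_eq: "hyp_inner p v w = v $ 1 * w $ 1 + (sinh (p $ 1))\<^sup>2 * v $ 2 * w $ 2"
  by (simp add: hyp_inner_def hyp_metric_def phi_def inner_vec_def matrix_vector_mult_def sum_2)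

lemma radial_le_speed: "\<bar>vector_derivative c (at t) $ 1\<bar> \<le> speed c t"
proof -
  have "\<bar>vector_derivative c (at t) $ 1\<bar> = sqrt ((vector_derivative c (at t) $ 1)\<^sup>2)"
    by simp
  also have "\<dots> \<le> speed c t"
    unfolding speed_def hyp_inner_eq
    by (intro real_sqrt_le_mono) (simp add: mult.assoc power2_eq_square[of "_ $ _", symmetric])
  finally show ?thesis .
qed

lemma norm_hyp_point: "p $ 1 \<ge> 0 \<Longrightarrow> norm (hyp_point p) = p $ 1"
  by (simp add: hyp_point_def)

lemma radial_change_le_curve_length:
  assumes "c C1_differentiable_on {0..1}"
  shows "\<bar>c 1 $ 1 - c 0 $ 1\<bar> \<le> curve_length c 0 1"
proof -
  obtain D where D: "\<And>t. t \<in> {0..1} \<Longrightarrow> (c has_vector_derivative D t) (at t)"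
    and contD: "continuous_on {0..1} D"
    using assms unfolding C1_differentiable_on_def by blast
  have vd: "vector_derivative c (at t) = D t" if "t \<in> {0..1}" for t
    using D[OF that] by (rule vector_derivative_at)
  have contc: "continuous_on {0..1} c"
    by (rule continuous_at_imp_continuous_on) (use D has_vector_derivative_continuous in blast)
  have ftc: "((\<lambda>t. D t $ 1) has_integral (c 1 $ 1 - c 0 $ 1)) {0..1}"
    by (rule fundamental_theorem_of_calculus)
      (auto intro!: has_vector_derivative_vec_nth has_vector_derivative_at_within[OF D])
  have "continuous_on {0..1}
      (\<lambda>t. sqrt (D t $ 1 * D t $ 1 + (sinh (c t $ 1))\<^sup>2 * D t $ 2 * D t $ 2))"
    by (intro continuous_intros contD contc)
  then have "continuous_on {0..1} (speed c)"
    by (rule continuous_on_eq) (simp add: speed_def hyp_inner_eq vd)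
  then have int: "speed c integrable_on {0..1}"
    by (rule integrable_continuous_interval)
  have "\<bar>integral {0..1} (\<lambda>t. D t $ 1)\<bar> \<le> integral {0..1} (speed c)"
    using integral_norm_bound_integral[OF has_integral_integrable[OF ftc] int]
      radial_le_speed[of c] vd by (metis real_norm_def)
  then show ?thesis
    using integral_unique[OF ftc] by (simp add: curve_length_def line_int_def)
qed

lemma hyp_dist_radial:
  assumes "a \<ge> 0" "b \<ge> 0"
  shows "hyp_dist (rcis a \<theta>) (rcis b \<theta>) = \<bar>a - b\<bar>"
proof -
  define P where "P = {curve_length c 0 1 | c. c C1_differentiable_on {0..1} \<and>
    (\<forall>t\<in>{0..1}. c t $ 1 \<ge> 0) \<and> hyp_point (c 0) = rcis a \<theta> \<and> hyp_point (c 1) = rcis b \<theta>}"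
  have lower: "\<bar>a - b\<bar> \<le> l" if l: "l \<in> P" for l
  proof -
    obtain c where c: "l = curve_length c 0 1" "c C1_differentiable_on {0..1}"
        "\<forall>t\<in>{0..1}. c t $ 1 \<ge> 0" "hyp_point (c 0) = rcis a \<theta>" "hyp_point (c 1) = rcis b \<theta>"
      using l unfolding P_def by blast
    have "c 0 $ 1 = a" "c 1 $ 1 = b"
      using norm_hyp_point[of "c 0"] norm_hyp_point[of "c 1"] c assms by auto
    then show ?thesis
      using radial_change_le_curve_length[OF c(2)] c(1) by simp
  qed
  define c :: "real \<Rightarrow> real^2" where "c t = vector [a + t * (b - a), \<theta>]" for t
  have der: "(c has_vector_derivative vector [b - a, 0]) (at t)" for t
    unfolding c_def
    by (intro has_vector_derivative_vector_2) (auto intro!: derivative_eq_intros)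
  have "c C1_differentiable_on {0..1}"
    unfolding C1_differentiable_on_def
    by (rule exI[of _ "\<lambda>_. vector [b - a, 0]"]) (use der in simp)
  moreover have "c t $ 1 \<ge> 0" if "t \<in> {0..1}" for t
  proof -
    have "c t $ 1 = (1 - t) * a + t * b"
      by (simp add: c_def algebra_simps)
    then show ?thesis
      using assms that by simp
  qed
  moreover have "hyp_point (c 0) = rcis a \<theta>" "hyp_point (c 1) = rcis b \<theta>"
    by (simp_all add: c_def hyp_point_def)
  moreover have "curve_length c 0 1 = \<bar>a - b\<bar>"
    by (simp add: curve_length_def line_int_def speed_def hyp_inner_eq
        vector_derivative_at[OF der] abs_minus_commute)
  ultimately have mem: "\<bar>a - b\<bar> \<in> P"
    unfolding P_def by (intro CollectI exI[of _ c]) auto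
  have "Inf P = \<bar>a - b\<bar>"
    using mem lower by (intro cInf_eq_minimum)
  then show ?thesis
    by (simp add: hyp_dist_def P_def)
qed

lemma geodesic_circle_origin: "geodesic_circle 0 R = {y. norm y = R}"
proof -
  have "hyp_dist 0 y = norm y" for y
    using hyp_dist_radial[of 0 "norm y" "Arg y"] by (simp add: rcis_cmod_Arg)
  then show ?thesis
    by (simp add: geodesic_circle_def)
qed

text \<open>
  Points of the graph and of the circle that have the same angle are at distance at most \<open>\<epsilon>\<close>.
\<close>

lemma hausdorff_dist_graph_circle_le:
  assumes pos: "\<And>\<theta>. \<rho> \<theta> > 0" and "R \<ge> 0" and close: "\<And>\<theta>. \<bar>\<rho> \<theta> - R\<bar> \<le> \<epsilon>"
  shows "hausdorff_dist (graph_set \<rho>) (geodesic_circle 0 R) \<le> \<epsilon>"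
proof (rule field_le_epsilon)
  fix e :: real assume "e > 0"
  define \<delta> where "\<delta> = \<epsilon> + e"
  have \<delta>: "\<delta> > 0" "\<bar>\<rho> \<theta> - R\<bar> < \<delta>" for \<theta>
    using close[of \<theta>] \<open>e > 0\<close> by (auto simp: \<delta>_def)
  have d: "hyp_dist (rcis (\<rho> \<theta>) \<theta>) (rcis R \<theta>) < \<delta>" "hyp_dist (rcis R \<theta>) (rcis (\<rho> \<theta>) \<theta>) < \<delta>" for \<theta>
    using \<delta>(2)[of \<theta>] pos[of \<theta>] \<open>R \<ge> 0\<close> by (simp_all add: hyp_dist_radial abs_minus_commute)
  have graph: "graph_set \<rho> = range (\<lambda>\<theta>. rcis (\<rho> \<theta>) \<theta>)"
    by (simp add: graph_set_def hyp_point_def graph_coords_def)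
  have circle: "geodesic_circle 0 R = range (rcis R)"
  proof -
    have "y \<in> range (rcis R)" if "norm y = R" for y
      by (rule image_eqI[of _ _ "Arg y"]) (simp_all add: rcis_cmod_Arg flip: that)
    then show ?thesis
      using \<open>R \<ge> 0\<close> by (auto simp: geodesic_circle_origin)
  qed
  have "hausdorff_dist (graph_set \<rho>) (geodesic_circle 0 R) \<le> \<delta>"
    unfolding hausdorff_dist_def
  proof (rule cInf_lower)
    show "\<delta> \<in> {\<delta>. \<delta> > 0 \<and> graph_set \<rho> \<subseteq> hyp_nhd \<delta> (geodesic_circle 0 R) \<and>
        geodesic_circle 0 R \<subseteq> hyp_nhd \<delta> (graph_set \<rho>)}"
      using \<delta>(1) d unfolding graph circle hyp_nhd_def by blast
    show "bdd_below {\<delta>. \<delta> > 0 \<and> graph_set \<rho> \<subseteq> hyp_nhd \<delta> (geodesic_circle 0 R) \<and>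
        geodesic_circle 0 R \<subseteq> hyp_nhd \<delta> (graph_set \<rho>)}"
      by (rule bdd_belowI[of _ 0]) auto
  qed
  then show "hausdorff_dist (graph_set \<rho>) (geodesic_circle 0 R) \<le> \<epsilon> + e"
    by (simp add: \<delta>_def)
qed

section \<open>The domain bounded by a continuous radial graph\<close>

text \<open>
  A positive continuous function of period \<open>2\<pi>\<close>. The graph and its domain are described by
  \<open>\<lambda>z. \<rho> (Arg z)\<close>, in which the jump of \<open>Arg\<close> is harmless because \<open>\<rho>\<close> is periodic.
\<close>

locale star_domain =
  fixes \<rho> :: "real \<Rightarrow> real"
  assumes cont: "continuous_on UNIV \<rho>"
    and periodic: "\<rho> (\<theta> + 2 * pi) = \<rho> \<theta>"
    and pos: "\<rho> \<theta> > 0"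
begin

lemma periodic_int: "\<rho> (\<theta> + of_int k * (2 * pi)) = \<rho> \<theta>"
proof -
  have nat: "\<rho> (\<theta> + of_nat n * (2 * pi)) = \<rho> \<theta>" for n \<theta>
  proof (induction n)
    case (Suc n)
    then show ?case
      using periodic[of "\<theta> + of_nat n * (2 * pi)"] by (simp add: algebra_simps)
  qed simp
  show ?thesis
  proof (cases "k \<ge> 0")
    case True
    then show ?thesis
      using nat[of \<theta> "nat k"] by simp
  next
    case False
    then show ?thesis
      using nat[of "\<theta> + of_int k * (2 * pi)" "nat (- k)"] by (simp add: algebra_simps)
  qed
qed

lemma rho_Arg_rcis:
  assumes "r > 0"
  shows "\<rho> (Arg (rcis r \<theta>)) = \<rho> \<theta>"
  using periodic_int[of \<theta> "- \<lceil>\<theta> / (2 * pi) - 1 / 2\<rceil>"] assms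
  by (simp add: Arg_rcis' normalize_angle_def)

lemma exists_fundamental_angle: "\<exists>\<theta>'\<in>{0..2 * pi}. \<rho> \<theta>' = \<rho> \<theta>"
proof -
  define k where "k = \<lfloor>\<theta> / (2 * pi)\<rfloor>"
  have "of_int k \<le> \<theta> / (2 * pi)" "\<theta> / (2 * pi) \<le> of_int k + 1"
    unfolding k_def by linarith+
  then have "of_int k * (2 * pi) \<le> \<theta>" "\<theta> \<le> (of_int k + 1) * (2 * pi)"
    by (simp_all add: field_simps)
  then have "\<theta> + of_int (- k) * (2 * pi) \<in> {0..2 * pi}"
    by (simp add: algebra_simps)
  then show ?thesis
    using periodic_int by blast
qed

lemma obtain_extrema:
  obtains \<theta>\<^sub>1 \<theta>\<^sub>2 where "\<theta>\<^sub>1 \<in> {0..2 * pi}" "\<theta>\<^sub>2 \<in> {0..2 * pi}"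
    "\<forall>\<theta>. \<rho> \<theta>\<^sub>1 \<le> \<rho> \<theta>" "\<forall>\<theta>. \<rho> \<theta> \<le> \<rho> \<theta>\<^sub>2"
proof -
  have ne: "{0..2 * pi} \<noteq> {}" by simp
  have c: "continuous_on {0..2 * pi} \<rho>"
    using cont continuous_on_subset by blast
  obtain \<theta>\<^sub>1 where 1: "\<theta>\<^sub>1 \<in> {0..2 * pi}" "\<And>\<theta>. \<theta> \<in> {0..2 * pi} \<Longrightarrow> \<rho> \<theta>\<^sub>1 \<le> \<rho> \<theta>"
    using continuous_attains_inf[OF compact_Icc ne c] by blast
  obtain \<theta>\<^sub>2 where 2: "\<theta>\<^sub>2 \<in> {0..2 * pi}" "\<And>\<theta>. \<theta> \<in> {0..2 * pi} \<Longrightarrow> \<rho> \<theta> \<le> \<rho> \<theta>\<^sub>2"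
    using continuous_attains_sup[OF compact_Icc ne c] by blast
  show ?thesis
  proof (rule that[OF 1(1) 2(1)]; rule allI)
    fix \<theta>
    obtain \<theta>' where "\<theta>' \<in> {0..2 * pi}" "\<rho> \<theta>' = \<rho> \<theta>"
      using exists_fundamental_angle by blast
    then show "\<rho> \<theta>\<^sub>1 \<le> \<rho> \<theta>" "\<rho> \<theta> \<le> \<rho> \<theta>\<^sub>2"
      using 1(2)[of \<theta>'] 2(2)[of \<theta>'] by simp_all
  qed
qed

lemma isCont_rho_Arg:
  assumes "z \<noteq> 0"
  shows "isCont (\<lambda>z. \<rho> (Arg z)) z"
proof (cases "z \<in> \<real>\<^sub>\<le>\<^sub>0")
  case False
  have "isCont \<rho> (Arg z)"
    using cont continuous_on_eq_continuous_at open_UNIV by blast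
  then show ?thesis
    by (rule isCont_o2[OF continuous_at_Arg[OF False]])
next
  case True
  then have "- z \<notin> \<real>\<^sub>\<le>\<^sub>0"
    using assms by (auto simp: complex_nonpos_Reals_iff complex_eq_iff)
  then have "isCont Arg (- z)"
    by (rule continuous_at_Arg)
  then have "isCont (\<lambda>z. Arg (- z) + pi) z"
    by (intro continuous_intros isCont_o2[of z uminus Arg])
  moreover have "isCont \<rho> (Arg (- z) + pi)"
    using cont continuous_on_eq_continuous_at open_UNIV by blast
  ultimately have "isCont (\<lambda>z. \<rho> (Arg (- z) + pi)) z"
    by (rule isCont_o2)
  \<comment> \<open>\<open>Arg (- w) + pi\<close> is an angle of \<open>w\<close> that is continuous across the cut of \<open>Arg\<close>.\<close>
  moreover have "eventually (\<lambda>w. \<rho> (Arg (- w) + pi) = \<rho> (Arg w)) (nhds z)"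
  proof -
    have "\<rho> (Arg (- w) + pi) = \<rho> (Arg w)" if "w \<noteq> 0" for w
    proof -
      have "rcis (norm w) (Arg (- w) + pi) = - rcis (norm (- w)) (Arg (- w))"
        by (simp add: rcis_def flip: cis_mult)
      then have "rcis (norm w) (Arg (- w) + pi) = w"
        unfolding rcis_cmod_Arg by simp
      then show ?thesis
        using rho_Arg_rcis[of "norm w" "Arg (- w) + pi"] that by simp
    qed
    moreover have "eventually (\<lambda>w. w \<noteq> 0) (nhds z)"
      using assms by (rule t1_space_nhds)
    ultimately show ?thesis
      by (auto elim: eventually_mono)
  qed
  ultimately show ?thesis
    by (simp add: isCont_cong)
qed

lemma open_sublevel: "open {z. norm z < \<rho> (Arg z)}"
  and open_superlevel: "open {z. norm z > \<rho> (Arg z)}"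
proof -
  obtain \<theta>\<^sub>1 where min: "\<And>\<theta>. \<rho> \<theta>\<^sub>1 \<le> \<rho> \<theta>"
    using obtain_extrema by metis
  define g where "g z = norm z - \<rho> (Arg z)" for z
  have "continuous_on (- {0}) g"
    unfolding g_def
    by (intro continuous_intros continuous_at_imp_continuous_on ballI isCont_rho_Arg) auto
  then have open_g: "open (- {0} \<inter> g -` T)" if "open T" for T
    using that by (intro continuous_open_preimage) auto
  have "{z. norm z < \<rho> (Arg z)} = ball 0 (\<rho> \<theta>\<^sub>1) \<union> (- {0} \<inter> g -` {..<0})"
    by (auto simp: g_def pos intro: less_le_trans[OF _ min])
  then show "open {z. norm z < \<rho> (Arg z)}"
    using open_g by auto
  have "{z. norm z > \<rho> (Arg z)} = - {0} \<inter> g -` {0<..}"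
    using pos[of "Arg 0"] by (auto simp: g_def)
  then show "open {z. norm z > \<rho> (Arg z)}"
    using open_g by auto
qed

lemma graph_set_eq: "graph_set \<rho> = {z. norm z = \<rho> (Arg z)}"
proof -
  have "z \<in> range (\<lambda>\<theta>. rcis (\<rho> \<theta>) \<theta>)" if "norm z = \<rho> (Arg z)" for z
    by (rule image_eqI[of _ _ "Arg z"]) (simp_all add: rcis_cmod_Arg flip: that)
  then show ?thesis
    using pos by (auto simp: graph_set_def hyp_point_def graph_coords_def rho_Arg_rcis less_imp_le)
qed

text \<open>
  The complement of the graph splits into the open sets \<open>|z| < \<rho> (Arg z)\<close> and
  \<open>|z| > \<rho> (Arg z)\<close>; the first is bounded, and every point of the second lies on a ray that
  leads to infinity without meeting the graph.
\<close>

lemma graph_domain_eq: "graph_domain \<rho> = {z. norm z < \<rho> (Arg z)}"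
proof -
  define U where "U = {z. norm z < \<rho> (Arg z)}"
  define E where "E = {z. norm z > \<rho> (Arg z)}"
  have compl: "- graph_set \<rho> = U \<union> E" "U \<inter> E = {}"
    by (auto simp: graph_set_eq U_def E_def)
  obtain \<theta>\<^sub>2 where max: "\<And>\<theta>. \<rho> \<theta> \<le> \<rho> \<theta>\<^sub>2"
    using obtain_extrema by metis
  have "U \<subseteq> ball 0 (\<rho> \<theta>\<^sub>2)"
    by (auto simp: U_def intro: less_le_trans[OF _ max])
  then have bounded: "bounded U"
    using bounded_ball bounded_subset by blast
  have inU: "bounded (connected_component_set (- graph_set \<rho>) z)" if "z \<in> U" for z
  proof -
    let ?C = "connected_component_set (- graph_set \<rho>) z"
    have "z \<in> ?C"
      using that compl by (intro CollectI connected_component_refl) auto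
    moreover have "?C \<subseteq> U \<union> E"
      using connected_component_subset compl by metis
    ultimately have "?C \<inter> E = {}"
      using connectedD[OF connected_connected_component, of U E "- graph_set \<rho>" z]
        open_sublevel open_superlevel compl(2) that unfolding U_def E_def by blast
    then have "?C \<subseteq> U"
      using \<open>?C \<subseteq> U \<union> E\<close> by blast
    then show ?thesis
      using bounded bounded_subset by blast
  qed
  have inE: "\<not> bounded (connected_component_set (- graph_set \<rho>) z)" if "z \<in> E" for z
  proof
    assume b: "bounded (connected_component_set (- graph_set \<rho>) z)"
    define ray where "ray = (\<lambda>t. rcis t (Arg z)) ` {norm z..}"
    have "norm z > 0"
      using that pos[of "Arg z"] unfolding E_def by (blast intro: less_trans)
    then have "norm (rcis t (Arg z)) \<noteq> \<rho> (Arg (rcis t (Arg z)))" if "t \<ge> norm z" for t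
    proof -
      have "t > 0"
        using that \<open>norm z > 0\<close> by linarith
      then show ?thesis
        using rho_Arg_rcis[of t "Arg z"] that \<open>z \<in> E\<close> by (simp add: E_def)
    qed
    then have "ray \<subseteq> - graph_set \<rho>"
      by (auto simp: ray_def graph_set_eq)
    moreover have "connected ray"
      unfolding ray_def rcis_def
      by (intro connected_continuous_image continuous_intros convex_connected) auto
    moreover have "z \<in> ray"
      unfolding ray_def by (rule image_eqI[of _ _ "norm z"]) (simp_all add: rcis_cmod_Arg)
    ultimately have "ray \<subseteq> connected_component_set (- graph_set \<rho>) z"
      by (intro connected_component_maximal)
    then have "bounded ray"
      using b bounded_subset by blast
    then obtain B where B: "\<And>w. w \<in> ray \<Longrightarrow> norm w \<le> B"
      unfolding bounded_iff by blast
    have "rcis (max (norm z) (B + 1)) (Arg z) \<in> ray"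
      by (simp add: ray_def)
    from B[OF this] show False
      by simp
  qed
  show ?thesis
    unfolding graph_domain_def inside_def using inU inE compl unfolding U_def E_def by blast
qed

text \<open>
  Integrating \<open>sinh\<close> from \<open>0\<close> to \<open>\<rho> \<theta>\<close> first gives \<open>cosh (\<rho> \<theta>) - 1\<close>.
\<close>

lemma graph_area_eq: "graph_area \<rho> = integral {0..2 * pi} (\<lambda>\<theta>. cosh (\<rho> \<theta>) - 1)"
proof -
  have [measurable]: "\<rho> \<in> borel_measurable borel"
    using cont by (rule borel_measurable_continuous_onI)
  define S where "S = {(r, \<theta>). 0 < r \<and> 0 \<le> \<theta> \<and> \<theta> < 2 * pi \<and> r < \<rho> \<theta>}"
  obtain \<theta>\<^sub>2 where max: "\<And>\<theta>. \<rho> \<theta> \<le> \<rho> \<theta>\<^sub>2"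
    using obtain_extrema by metis
  have coords: "{(r, \<theta>). 0 < r \<and> 0 \<le> \<theta> \<and> \<theta> < 2 * pi \<and> hyp_point (vector [r, \<theta>]) \<in> graph_domain \<rho>} = S"
    by (auto simp: S_def graph_domain_eq hyp_point_def rho_Arg_rcis)
  define F where "F = (\<lambda>r \<theta>. indicator S (r, \<theta>) *\<^sub>R sinh (r :: real))"
  have "{x \<in> space (borel \<Otimes>\<^sub>M borel). 0 < fst x \<and> 0 \<le> snd x \<and> snd x < 2 * pi \<and> fst x < \<rho> (snd x)}
      \<in> sets (borel \<Otimes>\<^sub>M borel)"
    by measurable
  then have S_sets: "S \<in> sets lborel"
    unfolding borel_prod by (simp add: S_def case_prod_unfold)
  have "set_integrable lborel (cbox (0, 0) (\<rho> \<theta>\<^sub>2, 2 * pi)) (\<lambda>x. sinh (fst x) :: real)"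
    unfolding set_integrable_def
    by (intro borel_integrable_compact continuous_intros compact_cbox)
  moreover have "S \<subseteq> cbox (0, 0) (\<rho> \<theta>\<^sub>2, 2 * pi)"
    by (auto simp: S_def intro: order_trans[OF less_imp_le max])
  ultimately have "set_integrable lborel S (\<lambda>x. sinh (fst x) :: real)"
    using S_sets set_integrable_subset by blast
  then have int: "integrable (lborel \<Otimes>\<^sub>M lborel) (case_prod F)"
    by (simp add: set_integrable_def lborel_prod F_def case_prod_unfold)
  have inner: "(\<integral>r. F r \<theta> \<partial>lborel) = indicator {0..<2 * pi} \<theta> *\<^sub>R (cosh (\<rho> \<theta>) - 1)" for \<theta>
  proof -
    have eq: "F r \<theta> = indicator {0..<2 * pi} \<theta> * (indicator {0<..<\<rho> \<theta>} r *\<^sub>R sinh r)" for r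
      by (auto simp: F_def S_def indicator_def)
    have "set_integrable lborel {0..\<rho> \<theta>} (sinh :: real \<Rightarrow> real)"
      unfolding set_integrable_def by (intro borel_integrable_compact continuous_intros compact_Icc)
    then have "set_integrable lborel {0<..<\<rho> \<theta>} (sinh :: real \<Rightarrow> real)"
      by (rule set_integrable_subset) auto
    then have "(LINT r:{0<..<\<rho> \<theta>}|lborel. sinh r) = integral {0..\<rho> \<theta>} (sinh :: real \<Rightarrow> real)"
      by (simp add: set_borel_integral_eq_integral(2) integral_open_interval_real)
    also have "\<dots> = cosh (\<rho> \<theta>) - cosh 0"
      using pos[of \<theta>]
      by (intro integral_unique fundamental_theorem_of_calculus)
        (auto intro!: derivative_eq_intros simp flip: has_real_derivative_iff_has_vector_derivative)
    finally show ?thesis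
      unfolding eq by (simp add: set_lebesgue_integral_def)
  qed
  have sinh: "sqrt (det (hyp_metric (vector [fst x, snd x]))) = sinh (fst x)" if "x \<in> S" for x
  proof -
    have "sinh (fst x) \<ge> 0"
      using that by (auto simp: S_def)
    then show ?thesis
      by (simp add: det_2 hyp_metric_def phi_def)
  qed
  have "graph_area \<rho> = (\<integral>x. case_prod F x \<partial>lborel)"
    unfolding graph_area_def hyp_area_def coords set_lebesgue_integral_def
    by (intro Bochner_Integration.integral_cong) (auto simp: F_def indicator_def case_prod_unfold sinh)
  also have "\<dots> = (\<integral>\<theta>. (\<integral>r. F r \<theta> \<partial>lborel) \<partial>lborel)"
    using lborel_pair.integral_snd[OF int] by (simp add: lborel_prod)
  also have "\<dots> = (LINT \<theta>:{0..<2 * pi}|lborel. cosh (\<rho> \<theta>) - 1)"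
    by (simp add: inner set_lebesgue_integral_def)
  also have "\<dots> = integral {0..<2 * pi} (\<lambda>\<theta>. cosh (\<rho> \<theta>) - 1)"
  proof (rule set_borel_integral_eq_integral(2))
    have "set_integrable lborel {0..2 * pi} (\<lambda>\<theta>. cosh (\<rho> \<theta>) - 1)"
      unfolding set_integrable_def
      by (intro borel_integrable_compact continuous_intros compact_Icc continuous_on_subset[OF cont]) auto
    then show "set_integrable lborel {0..<2 * pi} (\<lambda>\<theta>. cosh (\<rho> \<theta>) - 1)"
      by (rule set_integrable_subset) auto
  qed
  also have "\<dots> = integral {0..2 * pi} (\<lambda>\<theta>. cosh (\<rho> \<theta>) - 1)"
    by (rule integral_spike_set; rule negligible_subset[of "{2 * pi}"]) auto
  finally show ?thesis .
qed

end

section \<open>The Levi-Civita connection in polar coordinates\<close>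

lemma has_vector_derivative_graph_coords:
  assumes "(\<rho> has_real_derivative \<rho>') (at \<theta>)"
  shows "(graph_coords \<rho> has_vector_derivative vector [\<rho>', 1]) (at \<theta>)"
  unfolding graph_coords_def
  by (intro has_vector_derivative_vector_2 assms DERIV_ident)

lemma hyp_metric_component:
  "hyp_metric p $ i $ j = (if i = j then if i = 1 then 1 else (sinh (p $ 1))\<^sup>2 else 0)"
  using exhaust_2[of i] exhaust_2[of j] by (auto simp: hyp_metric_def phi_def)

lemma matrix_inv_eqI:
  fixes A B :: "real^'n^'n"
  assumes "A ** B = mat 1" "B ** A = mat 1"
  shows "matrix_inv A = B"
  unfolding matrix_inv_def
proof (rule some_equality)
  fix B' assume "A ** B' = mat 1 \<and> B' ** A = mat 1"
  then show "B' = B"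
    using assms by (metis matrix_mul_assoc matrix_mul_rid)
qed (use assms in blast)

lemma matrix_inv_hyp_metric:
  assumes "sinh (p $ 1) \<noteq> 0"
  shows "matrix_inv (hyp_metric p) = vector [vector [1, 0], vector [0, 1 / (sinh (p $ 1))\<^sup>2]]"
  by (rule matrix_inv_eqI)
    (use assms in \<open>simp_all add: vec_eq_iff forall_2 matrix_matrix_mult_def sum_2 hyp_metric_component mat_def\<close>)

lemma partial_deriv_hyp_metric:
  "partial_deriv i (\<lambda>q. hyp_metric q $ j $ l) p =
    (if i = 1 \<and> j = 2 \<and> l = 2 then 2 * sinh (p $ 1) * cosh (p $ 1) else 0)"
proof (cases "i = 1 \<and> j = 2 \<and> l = 2")
  case True
  have "((\<lambda>t. (sinh (p $ 1 + t))\<^sup>2) has_real_derivative 2 * sinh (p $ 1) * cosh (p $ 1)) (at 0)"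
    by (auto intro!: derivative_eq_intros)
  from DERIV_imp_deriv[OF this] show ?thesis
    using True by (simp add: partial_deriv_def hyp_metric_component axis_def)
next
  case False
  then have "(\<lambda>t. hyp_metric (p + t *\<^sub>R axis i 1) $ j $ l) = (\<lambda>t. hyp_metric p $ j $ l)"
    using exhaust_2[of i] exhaust_2[of j] exhaust_2[of l]
    by (auto simp: hyp_metric_component axis_def)
  then show ?thesis
    using False by (auto simp: partial_deriv_def)
qed

lemma christoffel_hyp:
  assumes "sinh (p $ 1) \<noteq> 0"
  shows "christoffel p 1 1 1 = 0" "christoffel p 1 1 2 = 0" "christoffel p 1 2 1 = 0"
    "christoffel p 1 2 2 = - sinh (p $ 1) * cosh (p $ 1)"
    "christoffel p 2 1 1 = 0" "christoffel p 2 2 2 = 0"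
    "christoffel p 2 1 2 = cosh (p $ 1) / sinh (p $ 1)"
    "christoffel p 2 2 1 = cosh (p $ 1) / sinh (p $ 1)"
  using assms
  by (simp_all add: christoffel_def matrix_inv_hyp_metric partial_deriv_hyp_metric sum_2 power2_eq_square)

section \<open>Frame, curvature and support function of a smooth radial graph\<close>

locale radial_graph =
  fixes \<rho> :: "real \<Rightarrow> real"
  assumes radial: "radial_function \<rho>"
begin

text \<open>
  The first two derivatives of the radial function.
\<close>

definition \<rho>\<^sub>1 :: "real \<Rightarrow> real" where "\<rho>\<^sub>1 = deriv \<rho>"
definition \<rho>\<^sub>2 :: "real \<Rightarrow> real" where "\<rho>\<^sub>2 = deriv \<rho>\<^sub>1"

lemma DERIV_rho: "(\<rho> has_real_derivative \<rho>\<^sub>1 \<theta>) (at \<theta>)"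
  and DERIV_rho\<^sub>1: "(\<rho>\<^sub>1 has_real_derivative \<rho>\<^sub>2 \<theta>) (at \<theta>)"
  and isCont_rho\<^sub>2: "isCont \<rho>\<^sub>2 \<theta>"
proof -
  have diff: "(deriv ^^ n) \<rho> differentiable (at x)" for n x
    using radial by (simp add: radial_function_def smooth_def)
  show "(\<rho> has_real_derivative \<rho>\<^sub>1 \<theta>) (at \<theta>)"
    using diff[of 0 \<theta>] by (simp add: \<rho>\<^sub>1_def DERIV_deriv_iff_real_differentiable)
  show "(\<rho>\<^sub>1 has_real_derivative \<rho>\<^sub>2 \<theta>) (at \<theta>)"
    using diff[of 1 \<theta>] by (simp add: \<rho>\<^sub>1_def \<rho>\<^sub>2_def DERIV_deriv_iff_real_differentiable)
  show "isCont \<rho>\<^sub>2 \<theta>"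
    using diff[of 2 \<theta>]
    by (simp add: \<rho>\<^sub>1_def \<rho>\<^sub>2_def eval_nat_numeral differentiable_imp_continuous_within)
qed

lemmas isCont_rho = DERIV_isCont[OF DERIV_rho]
lemmas isCont_rho\<^sub>1 = DERIV_isCont[OF DERIV_rho\<^sub>1]

sublocale star_domain \<rho>
proof
  show "continuous_on UNIV \<rho>"
    by (simp add: continuous_at_imp_continuous_on isCont_rho)
qed (use radial in \<open>auto simp: radial_function_def\<close>)

lemma periodic_rho\<^sub>1: "\<rho>\<^sub>1 (\<theta> + 2 * pi) = \<rho>\<^sub>1 \<theta>"
proof -
  have "((\<lambda>x. \<rho> (x + 2 * pi)) has_real_derivative \<rho>\<^sub>1 (\<theta> + 2 * pi)) (at \<theta>)"
    using DERIV_rho by (simp flip: DERIV_shift)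
  then have "(\<rho> has_real_derivative \<rho>\<^sub>1 (\<theta> + 2 * pi)) (at \<theta>)"
    by (simp add: periodic)
  then show ?thesis
    using DERIV_unique DERIV_rho by blast
qed

lemma sinh_rho_pos: "sinh (\<rho> \<theta>) > 0"
  using pos by simp

text \<open>
  The angle from \<open>\<partial>\<^sub>r\<close> to the outward normal, up to sign: the unit tangent is
  \<open>sin \<beta> \<partial>\<^sub>r + (cos \<beta> / sinh \<rho>) \<partial>\<^sub>\<theta>\<close>. It lies in \<open>(-\<pi>/2, \<pi>/2)\<close> since the curve is a graph.
\<close>

definition \<beta> :: "real \<Rightarrow> real" where
  "\<beta> \<theta> = arctan (\<rho>\<^sub>1 \<theta> / sinh (\<rho> \<theta>))"

text \<open>
  The derivative of \<open>\<beta>\<close> with respect to \<open>\<theta>\<close>.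
\<close>

definition \<beta>\<^sub>1 :: "real \<Rightarrow> real" where
  "\<beta>\<^sub>1 \<theta> = (\<rho>\<^sub>2 \<theta> * sinh (\<rho> \<theta>) - (\<rho>\<^sub>1 \<theta>)\<^sup>2 * cosh (\<rho> \<theta>)) / ((sinh (\<rho> \<theta>))\<^sup>2 + (\<rho>\<^sub>1 \<theta>)\<^sup>2)"

text \<open>
  The speed of the graph parametrized by \<open>\<theta>\<close>, so that \<open>ds = v d\<theta>\<close>; see \<open>speed_eq\<close>.
\<close>

definition v :: "real \<Rightarrow> real" where
  "v \<theta> = sinh (\<rho> \<theta>) / cos (\<beta> \<theta>)"

lemma cos_beta_pos: "cos (\<beta> \<theta>) > 0"
  unfolding \<beta>_def by (simp add: cos_arctan add_pos_nonneg)

lemma v_pos: "v \<theta> > 0"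
  using cos_beta_pos sinh_rho_pos by (simp add: v_def)

lemma sinh_eq: "sinh (\<rho> \<theta>) = v \<theta> * cos (\<beta> \<theta>)"
  using cos_beta_pos[of \<theta>] by (simp add: v_def)

lemma rho\<^sub>1_eq: "\<rho>\<^sub>1 \<theta> = v \<theta> * sin (\<beta> \<theta>)"
proof -
  have "tan (\<beta> \<theta>) = \<rho>\<^sub>1 \<theta> / sinh (\<rho> \<theta>)"
    by (simp add: \<beta>_def tan_arctan)
  then show ?thesis
    using sinh_rho_pos[of \<theta>] cos_beta_pos[of \<theta>] by (simp add: tan_def v_def field_simps)
qed

lemma DERIV_beta: "(\<beta> has_real_derivative \<beta>\<^sub>1 \<theta>) (at \<theta>)"
proof -
  have "(\<beta> has_real_derivative
      inverse (1 + (\<rho>\<^sub>1 \<theta> / sinh (\<rho> \<theta>))\<^sup>2) *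
        ((\<rho>\<^sub>2 \<theta> * sinh (\<rho> \<theta>) - \<rho>\<^sub>1 \<theta> * (cosh (\<rho> \<theta>) * \<rho>\<^sub>1 \<theta>)) / (sinh (\<rho> \<theta>) * sinh (\<rho> \<theta>)))) (at \<theta>)"
    unfolding \<beta>_def[abs_def] using sinh_rho_pos[of \<theta>]
    by (auto intro!: derivative_eq_intros DERIV_rho DERIV_rho\<^sub>1)
  also have "inverse (1 + (\<rho>\<^sub>1 \<theta> / sinh (\<rho> \<theta>))\<^sup>2) *
        ((\<rho>\<^sub>2 \<theta> * sinh (\<rho> \<theta>) - \<rho>\<^sub>1 \<theta> * (cosh (\<rho> \<theta>) * \<rho>\<^sub>1 \<theta>)) / (sinh (\<rho> \<theta>) * sinh (\<rho> \<theta>))) = \<beta>\<^sub>1 \<theta>"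
  proof -
    have "inverse (1 + (x / s)\<^sup>2) * (N / (s * s)) = N / (s\<^sup>2 + x\<^sup>2)" if "s > 0" for x s N :: real
    proof -
      have "1 + (x / s)\<^sup>2 = (s\<^sup>2 + x\<^sup>2) / (s * s)"
        using that by (simp add: power2_eq_square field_simps)
      then show ?thesis
        using that by simp
    qed
    from this[OF sinh_rho_pos[of \<theta>], of "\<rho>\<^sub>1 \<theta>" "\<rho>\<^sub>2 \<theta> * sinh (\<rho> \<theta>) - \<rho>\<^sub>1 \<theta> * (cosh (\<rho> \<theta>) * \<rho>\<^sub>1 \<theta>)"]
    show ?thesis
      by (simp add: \<beta>\<^sub>1_def power2_eq_square mult_ac)
  qed
  finally show ?thesis .
qed

lemmas isCont_beta = DERIV_isCont[OF DERIV_beta]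

lemma isCont_beta\<^sub>1: "isCont \<beta>\<^sub>1 \<theta>"
proof -
  have "(sinh (\<rho> \<theta>))\<^sup>2 + (\<rho>\<^sub>1 \<theta>)\<^sup>2 \<noteq> 0"
    using sinh_rho_pos[of \<theta>] by simp
  then show ?thesis
    unfolding \<beta>\<^sub>1_def[abs_def]
    by (intro continuous_intros isCont_rho isCont_rho\<^sub>1 isCont_rho\<^sub>2)
qed

lemma isCont_v: "isCont v \<theta>"
  unfolding v_def[abs_def] using cos_beta_pos[of \<theta>]
  by (intro continuous_intros isCont_rho isCont_beta) auto

lemma vector_derivative_graph_coords:
  "vector_derivative (graph_coords \<rho>) (at \<theta>) = vector [\<rho>\<^sub>1 \<theta>, 1]"
  by (intro vector_derivative_at has_vector_derivative_graph_coords DERIV_rho)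

lemma speed_eq: "speed (graph_coords \<rho>) \<theta> = v \<theta>"
proof -
  have "(\<rho>\<^sub>1 \<theta>)\<^sup>2 + (sinh (\<rho> \<theta>))\<^sup>2 = (v \<theta>)\<^sup>2 * ((sin (\<beta> \<theta>))\<^sup>2 + (cos (\<beta> \<theta>))\<^sup>2)"
    by (simp only: rho\<^sub>1_eq sinh_eq power_mult_distrib distrib_left)
  then have "\<rho>\<^sub>1 \<theta> * \<rho>\<^sub>1 \<theta> + (sinh (\<rho> \<theta>))\<^sup>2 = (v \<theta>)\<^sup>2"
    by (simp add: power2_eq_square[of "\<rho>\<^sub>1 \<theta>"])
  then show ?thesis
    using v_pos[of \<theta>]
    by (simp add: speed_def hyp_inner_eq vector_derivative_graph_coords graph_coords_def)
qed

lemma unit_tangent_eq: "unit_tangent \<rho> \<theta> = vector [sin (\<beta> \<theta>), cos (\<beta> \<theta>) / sinh (\<rho> \<theta>)]"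
proof -
  have "cos (\<beta> \<theta>) / sinh (\<rho> \<theta>) = 1 / v \<theta>"
    by (simp add: v_def)
  moreover have "\<rho>\<^sub>1 \<theta> / v \<theta> = sin (\<beta> \<theta>)"
    using v_pos[of \<theta>] by (simp add: rho\<^sub>1_eq)
  ultimately show ?thesis
    by (simp add: unit_tangent_def speed_eq vector_derivative_graph_coords vec_eq_iff forall_2)
qed

lemma unit_normal_eq: "unit_normal \<rho> \<theta> = vector [cos (\<beta> \<theta>), - sin (\<beta> \<theta>) / sinh (\<rho> \<theta>)]"
  unfolding unit_normal_def
proof (rule the_equality)
  let ?s = "sin (\<beta> \<theta>)" and ?c = "cos (\<beta> \<theta>)" and ?S = "sinh (\<rho> \<theta>)"
  have S: "?S > 0" and c: "?c > 0"
    by (fact sinh_rho_pos cos_beta_pos)+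
  have sc: "?s * ?s + ?c * ?c = 1"
    using sin_cos_squared_add[of "\<beta> \<theta>"] by (simp add: power2_eq_square)
  show "hyp_inner (graph_coords \<rho> \<theta>) (vector [?c, - ?s / ?S]) (unit_tangent \<rho> \<theta>) = 0 \<and>
      hyp_inner (graph_coords \<rho> \<theta>) (vector [?c, - ?s / ?S]) (vector [?c, - ?s / ?S]) = 1 \<and>
      (vector [?c, - ?s / ?S] :: real^2) $ 1 > 0"
    using S c sc by (simp add: hyp_inner_eq graph_coords_def unit_tangent_eq power2_eq_square)
  fix n :: "real^2"
  assume n: "hyp_inner (graph_coords \<rho> \<theta>) n (unit_tangent \<rho> \<theta>) = 0 \<and>
    hyp_inner (graph_coords \<rho> \<theta>) n n = 1 \<and> n $ 1 > 0"
  define q where "q = ?S * n $ 2"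
  have orth: "n $ 1 * ?s + q * ?c = 0" and unit: "n $ 1 * n $ 1 + q * q = 1" and "n $ 1 > 0"
    using n S by (simp_all add: hyp_inner_eq graph_coords_def unit_tangent_eq q_def power2_eq_square mult_ac)
  have "(n $ 1)\<^sup>2 = ?c\<^sup>2"
    using orth unit sc by algebra
  then have n1: "n $ 1 = ?c"
    using \<open>n $ 1 > 0\<close> c by simp
  then have "(q + ?s) * ?c = 0"
    using orth by (simp add: algebra_simps)
  then have "q = - ?s"
    using c by simp
  then show "n = vector [?c, - ?s / ?S]"
    using n1 S by (simp add: vec_eq_iff forall_2 q_def field_simps)
qed

text \<open>
  The covariant derivative of the unit tangent is \<open>(\<beta>\<^sub>1 - cosh \<rho>)\<close> times the unit normal.
\<close>

lemma curvature_eq: "curvature \<rho> \<theta> = (cosh (\<rho> \<theta>) - \<beta>\<^sub>1 \<theta>) / v \<theta>"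
proof -
  let ?s = "sin (\<beta> \<theta>)" and ?c = "cos (\<beta> \<theta>)" and ?S = "sinh (\<rho> \<theta>)" and ?C = "cosh (\<rho> \<theta>)"
  let ?X = "unit_tangent \<rho>" and ?p = "graph_coords \<rho> \<theta>"
  have S: "?S > 0" and c: "?c > 0"
    by (fact sinh_rho_pos cos_beta_pos)+
  have "(?X has_vector_derivative
      vector [?c * \<beta>\<^sub>1 \<theta>, (- ?s * \<beta>\<^sub>1 \<theta> * ?S - ?c * (?C * \<rho>\<^sub>1 \<theta>)) / (?S * ?S)]) (at \<theta>)"
    unfolding unit_tangent_eq[abs_def]
    by (intro has_vector_derivative_vector_2)
      (use S in \<open>auto intro!: derivative_eq_intros DERIV_beta DERIV_rho\<close>)
  note X' = vector_derivative_at[OF this]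
  have "cov_deriv (graph_coords \<rho>) ?X \<theta> $ 1 = ?c * \<beta>\<^sub>1 \<theta> - ?S * ?C * (?c / ?S)"
    using S by (simp add: cov_deriv_def X' vector_derivative_graph_coords sum_2 christoffel_hyp
        unit_tangent_eq graph_coords_def)
  then have cov1: "cov_deriv (graph_coords \<rho>) ?X \<theta> $ 1 = ?c * (\<beta>\<^sub>1 \<theta> - ?C)"
    using S by (simp add: algebra_simps)
  have "cov_deriv (graph_coords \<rho>) ?X \<theta> $ 2 =
      (- ?s * \<beta>\<^sub>1 \<theta> * ?S - ?c * (?C * \<rho>\<^sub>1 \<theta>)) / (?S * ?S) + ?C / ?S * (\<rho>\<^sub>1 \<theta> * (?c / ?S) + ?s)"
    using S by (simp add: cov_deriv_def X' vector_derivative_graph_coords sum_2 christoffel_hyp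
        unit_tangent_eq graph_coords_def algebra_simps)
  also have "\<dots> = ?s * (?C - \<beta>\<^sub>1 \<theta>) / ?S"
    using S by (simp add: field_simps)
  finally have cov2: "cov_deriv (graph_coords \<rho>) ?X \<theta> $ 2 = ?s * (?C - \<beta>\<^sub>1 \<theta>) / ?S" .
  have "hyp_inner ?p (cov_deriv (graph_coords \<rho>) ?X \<theta>) (unit_normal \<rho> \<theta>) =
      ?c * (\<beta>\<^sub>1 \<theta> - ?C) * ?c + ?S\<^sup>2 * (?s * (?C - \<beta>\<^sub>1 \<theta>) / ?S) * (- ?s / ?S)"
    by (simp add: hyp_inner_eq cov1 cov2 unit_normal_eq graph_coords_def)
  also have "\<dots> = (\<beta>\<^sub>1 \<theta> - ?C) * (?c\<^sup>2 + ?s\<^sup>2)"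
  proof -
    have "c * (b - C) * c + S\<^sup>2 * (s * (C - b) / S) * (- s / S) = (b - C) * (c\<^sup>2 + s\<^sup>2)"
      if "S > 0" for b c s C S :: real
      using that by (simp add: field_simps power2_eq_square)
    from this[OF S] show ?thesis .
  qed
  finally have "hyp_inner ?p (cov_deriv (graph_coords \<rho>) ?X \<theta>) (unit_normal \<rho> \<theta>) = \<beta>\<^sub>1 \<theta> - ?C"
    by simp
  moreover have "hyp_inner ?p (a *\<^sub>R x) y = a * hyp_inner ?p x y" for a x y
    by (simp add: hyp_inner_eq algebra_simps)
  ultimately show ?thesis
    by (simp add: curvature_def speed_eq diff_divide_distrib)
qed

lemma support_eq: "support \<rho> \<theta> = sinh (\<rho> \<theta>) * cos (\<beta> \<theta>)"
  by (simp add: support_def hyp_inner_eq V_field_def phi_def unit_normal_eq graph_coords_def)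

end

section \<open>Auxiliary real analysis\<close>

lemma diff_power3_le:
  fixes x y :: real
  assumes "y \<le> x"
  shows "(x - y) ^ 3 \<le> 4 * (x ^ 3 - y ^ 3)"
proof -
  have "4 * (x ^ 3 - y ^ 3) - (x - y) ^ 3 = 3 * (x - y) * (x + y)\<^sup>2"
    by (simp add: power2_eq_square power3_eq_cube algebra_simps)
  also have "\<dots> \<ge> 0"
    using assms by simp
  finally show ?thesis by simp
qed

lemma powr_third_le_stab_fun:
  assumes "s \<ge> 0"
  shows "s powr (1 / 3) \<le> stab_fun s"
proof (cases "s \<le> 1")
  case True
  then have "s powr (1 / 3) \<le> s powr (1 / 6)"
    using assms by (intro powr_mono') auto
  then show ?thesis
    by (simp add: stab_fun_def add_increasing)
next
  case False
  then have "s powr (1 / 3) \<le> s powr (1 / 2)"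
    by (intro powr_mono) auto
  then show ?thesis
    by (simp add: stab_fun_def add_increasing2)
qed

lemma has_integral_DERIV:
  fixes f :: "real \<Rightarrow> real"
  assumes "a \<le> b" "\<And>x. (f has_real_derivative f' x) (at x)"
  shows "(f' has_integral (f b - f a)) {a..b}"
  using assms(1)
proof (rule fundamental_theorem_of_calculus)
  show "(f has_vector_derivative f' x) (at x within {a..b})" for x
    using assms(2)[of x] unfolding has_real_derivative_iff_has_vector_derivative
    by (rule has_vector_derivative_at_within)
qed

lemma integrable_on_if_isCont:
  fixes f :: "real \<Rightarrow> real"
  shows "(\<And>x. isCont f x) \<Longrightarrow> f integrable_on {a..b}"
  by (intro integrable_continuous_interval continuous_at_imp_continuous_on) auto

section \<open>The horospherical Gauss map\<close>

context radial_graph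
begin

text \<open>
  The time component of the null vector \<open>X - \<nu>\<close>, that is, \<open>cosh \<rho>\<close> minus the support function.
\<close>

definition w :: "real \<Rightarrow> real" where
  "w \<theta> = cosh (\<rho> \<theta>) - sinh (\<rho> \<theta>) * cos (\<beta> \<theta>)"

text \<open>
  The density of the measure \<open>(\<kappa> - 1) ds\<close> with respect to \<open>\<theta>\<close>; see \<open>curvature_minus_1\<close>.
\<close>

definition \<mu> :: "real \<Rightarrow> real" where
  "\<mu> \<theta> = cosh (\<rho> \<theta>) - \<beta>\<^sub>1 \<theta> - v \<theta>"

text \<open>
  The horospherical Gauss map: \<open>X - \<nu> = w (1, - cis \<psi>)\<close>. The spatial part of \<open>X - \<nu>\<close> is
  \<open>(sinh \<rho> - cosh \<rho> cos \<beta>) \<partial>\<^sub>r + sin \<beta> \<partial>\<^sub>\<theta>\<close> with \<open>\<partial>\<^sub>\<theta>\<close> normalized; the half-angle formula for the tangent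
  turns its argument into an expression that is smooth for all values of \<open>\<rho>\<close> and \<open>\<beta>\<close>.
\<close>

definition \<psi> :: "real \<Rightarrow> real" where
  "\<psi> \<theta> = \<theta> - 2 * arctan (exp (\<rho> \<theta>) * (sin (\<beta> \<theta>) / (1 + cos (\<beta> \<theta>))))"

lemma w_pos: "w \<theta> > 0"
proof -
  have "sinh (\<rho> \<theta>) * cos (\<beta> \<theta>) \<le> sinh (\<rho> \<theta>)"
    using sinh_rho_pos[of \<theta>] by (intro mult_left_le) auto
  also have "\<dots> < cosh (\<rho> \<theta>)"
    using cosh_minus_sinh[of "\<rho> \<theta>"] by (metis exp_gt_zero diff_gt_0_iff_gt)
  finally show ?thesis
    by (simp add: w_def)
qed

lemma w_le: "w \<theta> \<le> cosh (\<rho> \<theta>)"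
  using sinh_rho_pos[of \<theta>] cos_beta_pos[of \<theta>] by (simp add: w_def)

lemma DERIV_w: "(w has_real_derivative - sinh (\<rho> \<theta>) * sin (\<beta> \<theta>) * \<mu> \<theta>) (at \<theta>)"
proof -
  have "(w has_real_derivative
      sinh (\<rho> \<theta>) * \<rho>\<^sub>1 \<theta> - (cosh (\<rho> \<theta>) * \<rho>\<^sub>1 \<theta> * cos (\<beta> \<theta>) - sinh (\<rho> \<theta>) * (sin (\<beta> \<theta>) * \<beta>\<^sub>1 \<theta>))) (at \<theta>)"
    unfolding w_def[abs_def]
    by (auto intro!: derivative_eq_intros DERIV_rho DERIV_beta)
  moreover have "sinh (\<rho> \<theta>) * \<rho>\<^sub>1 \<theta> -
      (cosh (\<rho> \<theta>) * \<rho>\<^sub>1 \<theta> * cos (\<beta> \<theta>) - sinh (\<rho> \<theta>) * (sin (\<beta> \<theta>) * \<beta>\<^sub>1 \<theta>)) =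
      - sinh (\<rho> \<theta>) * sin (\<beta> \<theta>) * \<mu> \<theta>"
    using rho\<^sub>1_eq[of \<theta>] sinh_eq[of \<theta>] unfolding \<mu>_def by algebra
  ultimately show ?thesis by simp
qed

lemma DERIV_psi: "(\<psi> has_real_derivative \<mu> \<theta> / w \<theta>) (at \<theta>)"
proof -
  define e s c b r where "e = exp (\<rho> \<theta>)" and "s = sin (\<beta> \<theta>)" and "c = cos (\<beta> \<theta>)"
    and "b = \<beta>\<^sub>1 \<theta>" and "r = \<rho>\<^sub>1 \<theta>"
  note defs = e_def[symmetric] s_def[symmetric] c_def[symmetric] b_def[symmetric] r_def[symmetric]
  have c: "c > 0" and e: "e > 0"
    using cos_beta_pos by (simp_all add: c_def e_def)
  have sc: "s\<^sup>2 + c\<^sup>2 = 1"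
    by (simp add: s_def c_def)
  have "1 + c \<noteq> 0" "w \<theta> > 0"
    using c w_pos by auto
  have "((\<lambda>\<theta>. sin (\<beta> \<theta>)) has_real_derivative c * b) (at \<theta>)"
      "((\<lambda>\<theta>. 1 + cos (\<beta> \<theta>)) has_real_derivative - (s * b)) (at \<theta>)"
    by (auto intro!: derivative_eq_intros DERIV_beta simp: defs)
  from DERIV_divide[OF this] have "((\<lambda>\<theta>. sin (\<beta> \<theta>) / (1 + cos (\<beta> \<theta>))) has_real_derivative
      (c * b * (1 + c) + s * (s * b)) / ((1 + c) * (1 + c))) (at \<theta>)"
    using \<open>1 + c \<noteq> 0\<close> by (simp add: defs)
  note DERIV_mult[OF DERIV_chain2[OF DERIV_exp DERIV_rho] this]
  note DERIV_diff[OF DERIV_ident DERIV_cmult[OF DERIV_chain2[OF DERIV_arctan this], of 2]]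
  then have "(\<psi> has_real_derivative
      1 - 2 * (inverse (1 + (e * (s / (1 + c)))\<^sup>2) *
        (e * r * (s / (1 + c)) + (c * b * (1 + c) + s * (s * b)) / ((1 + c) * (1 + c)) * e))) (at \<theta>)"
    unfolding \<psi>_def[abs_def] defs .
  also have "c * b * (1 + c) + s * (s * b) = b * (1 + c)"
    using sc by algebra
  \<comment> \<open>As \<open>s\<^sup>2 = (1 - c) * (1 + c)\<close>, the denominator of the derivative of \<open>arctan\<close> is a multiple of \<open>w\<close>.\<close>
  also have "1 + (e * (s / (1 + c)))\<^sup>2 = 2 * e * w \<theta> / (1 + c)"
  proof -
    have "2 * e * cosh (\<rho> \<theta>) = e\<^sup>2 + 1" "2 * e * sinh (\<rho> \<theta>) = e\<^sup>2 - 1"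
      using e by (simp_all add: cosh_def sinh_def e_def exp_minus field_simps power2_eq_square)
    then have "(1 + c)\<^sup>2 + e\<^sup>2 * s\<^sup>2 = 2 * e * w \<theta> * (1 + c)"
      using sc unfolding w_def defs by algebra
    moreover have "1 + (e * (s / (1 + c)))\<^sup>2 = ((1 + c)\<^sup>2 + e\<^sup>2 * s\<^sup>2) / (1 + c)\<^sup>2"
      using \<open>1 + c \<noteq> 0\<close> by (simp add: power_divide power_mult_distrib add_divide_distrib)
    ultimately show ?thesis
      using \<open>1 + c \<noteq> 0\<close> by (simp add: power2_eq_square)
  qed
  also have "e * r * (s / (1 + c)) + b * (1 + c) / ((1 + c) * (1 + c)) * e = (r * s + b) * e / (1 + c)"
    using nonzero_mult_divide_mult_cancel_right[OF \<open>1 + c \<noteq> 0\<close>, of b "1 + c"]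
    by (simp only: times_divide_eq_right times_divide_eq_left add_divide_distrib[symmetric])
      (simp add: algebra_simps add_divide_distrib)
  also have "1 - 2 * (inverse (2 * e * w \<theta> / (1 + c)) * ((r * s + b) * e / (1 + c)))
      = (w \<theta> - r * s - b) / w \<theta>"
  proof -
    have "1 - 2 * (inverse (2 * e * W / d) * (x * e / d)) = (W - x) / W"
      if "d \<noteq> 0" "W > 0" for d W x :: real
      using that e by (simp add: field_simps)
    from this[OF \<open>1 + c \<noteq> 0\<close> \<open>w \<theta> > 0\<close>] show ?thesis
      by (simp add: diff_diff_eq)
  qed
  also have "w \<theta> - r * s - b = \<mu> \<theta>"
  proof -
    have "r = v \<theta> * s" "sinh (\<rho> \<theta>) = v \<theta> * c"
      by (simp_all add: r_def s_def c_def rho\<^sub>1_eq sinh_eq)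
    then show ?thesis
      using sc unfolding w_def \<mu>_def defs by algebra
  qed
  finally show ?thesis .
qed

lemma periodic_beta: "\<beta> (\<theta> + 2 * pi) = \<beta> \<theta>"
  by (simp add: \<beta>_def periodic periodic_rho\<^sub>1)

lemma has_integral_beta\<^sub>1: "(\<beta>\<^sub>1 has_integral 0) {0..2 * pi}"
proof -
  have "(\<beta>\<^sub>1 has_integral (\<beta> (2 * pi) - \<beta> 0)) {0..2 * pi}"
    by (intro has_integral_DERIV DERIV_beta) simp
  then show ?thesis
    using periodic_beta[of 0] by simp
qed

text \<open>
  The horospherical Gauss map makes one turn.
\<close>

lemma has_integral_psi': "((\<lambda>\<theta>. \<mu> \<theta> / w \<theta>) has_integral 2 * pi) {0..2 * pi}"
proof -
  have "((\<lambda>\<theta>. \<mu> \<theta> / w \<theta>) has_integral (\<psi> (2 * pi) - \<psi> 0)) {0..2 * pi}"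
    by (intro has_integral_DERIV DERIV_psi) simp
  moreover have "\<psi> (2 * pi) - \<psi> 0 = 2 * pi"
    using periodic_beta[of 0] periodic[of 0] by (simp add: \<psi>_def)
  ultimately show ?thesis by simp
qed

lemma isCont_mu: "isCont \<mu> \<theta>"
  unfolding \<mu>_def[abs_def] by (intro continuous_intros isCont_rho isCont_beta\<^sub>1 isCont_v)

lemmas isCont_w = DERIV_isCont[OF DERIV_w]

section \<open>The deficit as a variance\<close>

text \<open>
  The deficit, the argument of \<open>stab_fun\<close> in the theorem. It vanishes for circles about the origin.
\<close>

definition Q :: real where
  "Q = graph_int \<rho> (\<lambda>\<theta>. (Phi (\<rho> \<theta>) - support \<rho> \<theta>) * (curvature \<rho> \<theta> - 1))
    + (graph_length \<rho> - graph_area \<rho>) - 1 / (2 * pi) * (graph_length \<rho> - graph_area \<rho>)\<^sup>2"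

text \<open>
  The mean of \<open>w\<close> with respect to \<open>\<psi>\<close>; the integrand is \<open>w\<close> times the derivative \<open>\<mu> / w\<close> of \<open>\<psi>\<close>.
\<close>

definition w_mean :: real where
  "w_mean = integral {0..2 * pi} \<mu> / (2 * pi)"

lemma curvature_minus_1: "(curvature \<rho> \<theta> - 1) * v \<theta> = \<mu> \<theta>"
  using v_pos[of \<theta>] by (simp add: curvature_eq \<mu>_def field_simps)

text \<open>
  Gauss-Bonnet. The curvature form \<open>\<kappa> ds\<close> is \<open>(cosh \<rho> - \<beta>\<^sub>1) d\<theta>\<close>, and \<open>\<beta>\<^sub>1\<close> integrates to \<open>0\<close>.
\<close>

lemma gauss_bonnet: "integral {0..2 * pi} \<mu> = 2 * pi - (graph_length \<rho> - graph_area \<rho>)"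
proof -
  have int: "(\<lambda>\<theta>. cosh (\<rho> \<theta>)) integrable_on {0..2 * pi}" "v integrable_on {0..2 * pi}"
    by (intro integrable_on_if_isCont continuous_intros isCont_rho isCont_v)+
  have "graph_length \<rho> = integral {0..2 * pi} v"
    by (simp add: graph_length_def curve_length_def line_int_def speed_eq)
  moreover have "graph_area \<rho> = integral {0..2 * pi} (\<lambda>\<theta>. cosh (\<rho> \<theta>)) - 2 * pi"
    unfolding graph_area_eq by (simp add: integral_diff[OF int(1) integrable_const_ivl])
  moreover have "integral {0..2 * pi} \<mu> =
      integral {0..2 * pi} (\<lambda>\<theta>. cosh (\<rho> \<theta>)) - integral {0..2 * pi} v"
    unfolding \<mu>_def[abs_def] using int has_integral_beta\<^sub>1
    by (simp add: integral_diff integrable_diff has_integral_integrable integral_unique)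
  ultimately show ?thesis by simp
qed

text \<open>
  The deficit is the variance of \<open>w\<close> with respect to \<open>\<psi>\<close>, written as an integral over \<open>\<theta>\<close>.
\<close>

lemma has_integral_variance: "((\<lambda>\<theta>. (w \<theta> - w_mean)\<^sup>2 * (\<mu> \<theta> / w \<theta>)) has_integral Q) {0..2 * pi}"
proof -
  let ?I = "integral {0..2 * pi} \<mu>" and ?J = "integral {0..2 * pi} (\<lambda>\<theta>. w \<theta> * \<mu> \<theta>)"
  have int: "(\<mu> has_integral ?I) {0..2 * pi}" "((\<lambda>\<theta>. w \<theta> * \<mu> \<theta>) has_integral ?J) {0..2 * pi}"
    by (intro integrable_integral integrable_on_if_isCont continuous_intros isCont_mu isCont_w)+
  have "graph_int \<rho> (\<lambda>\<theta>. (Phi (\<rho> \<theta>) - support \<rho> \<theta>) * (curvature \<rho> \<theta> - 1)) =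
      integral {0..2 * pi} (\<lambda>\<theta>. w \<theta> * \<mu> \<theta> - \<mu> \<theta>)"
    unfolding graph_int_def line_int_def speed_eq mult.assoc curvature_minus_1
    by (simp add: Phi_def support_eq w_def algebra_simps)
  also have "\<dots> = ?J - ?I"
    by (intro integral_unique has_integral_diff int)
  finally have Q: "Q = ?J - ?I + (2 * pi - ?I) - 1 / (2 * pi) * (2 * pi - ?I)\<^sup>2"
    by (simp add: Q_def gauss_bonnet)
  have "((\<lambda>\<theta>. w \<theta> * \<mu> \<theta> - 2 * w_mean * \<mu> \<theta> + w_mean\<^sup>2 * (\<mu> \<theta> / w \<theta>)) has_integral
      ?J - 2 * w_mean * ?I + w_mean\<^sup>2 * (2 * pi)) {0..2 * pi}"
    by (intro has_integral_add has_integral_diff has_integral_mult_right int has_integral_psi')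
  moreover have "w \<theta> * \<mu> \<theta> - 2 * w_mean * \<mu> \<theta> + w_mean\<^sup>2 * (\<mu> \<theta> / w \<theta>) =
      (w \<theta> - w_mean)\<^sup>2 * (\<mu> \<theta> / w \<theta>)" for \<theta>
    using w_pos[of \<theta>] by (simp add: field_simps power2_eq_square)
  moreover have "?J - 2 * w_mean * ?I + w_mean\<^sup>2 * (2 * pi) = Q"
    unfolding Q w_mean_def by (simp add: field_simps power2_eq_square)
  ultimately show ?thesis by simp
qed

lemma rho\<^sub>1_eq_0_at_extremum:
  assumes "(\<forall>\<theta>. \<rho> \<theta> \<le> \<rho> \<theta>\<^sub>0) \<or> (\<forall>\<theta>. \<rho> \<theta>\<^sub>0 \<le> \<rho> \<theta>)"
  shows "\<rho>\<^sub>1 \<theta>\<^sub>0 = 0"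
  using assms DERIV_local_max[OF DERIV_rho, of 1 \<theta>\<^sub>0] DERIV_local_min[OF DERIV_rho, of 1 \<theta>\<^sub>0] by auto

lemma w_at_extremum:
  assumes "(\<forall>\<theta>. \<rho> \<theta> \<le> \<rho> \<theta>\<^sub>0) \<or> (\<forall>\<theta>. \<rho> \<theta>\<^sub>0 \<le> \<rho> \<theta>)"
  shows "w \<theta>\<^sub>0 = exp (- \<rho> \<theta>\<^sub>0)"
  using rho\<^sub>1_eq_0_at_extremum[OF assms] by (simp add: w_def \<beta>_def cosh_minus_sinh)

end

section \<open>Stability\<close>

locale h_convex_graph = radial_graph +
  assumes h_convex: "strictly_h_convex \<rho>"
begin

lemma mu_pos: "\<mu> \<theta> > 0"
  using h_convex v_pos[of \<theta>] by (simp add: strictly_h_convex_def flip: curvature_minus_1)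

lemma Q_nonneg: "Q \<ge> 0"
  using has_integral_variance
  by (rule has_integral_nonneg) (simp add: mu_pos w_pos less_imp_le)

text \<open>
  The derivative of \<open>w\<close> is at most \<open>cosh M * sinh M\<close> times that of \<open>\<psi>\<close>, so the derivative of
  \<open>(w - w_mean)\<^sup>3\<close> is at most \<open>3 * (cosh M * sinh M)\<close> times the integrand of the variance.
\<close>

lemma cube_deviation_le_aux:
  assumes "0 \<le> a" "a \<le> b" "b \<le> 2 * pi" and max: "\<And>\<theta>. \<rho> \<theta> \<le> M"
  shows "\<bar>(w b - w_mean) ^ 3 - (w a - w_mean) ^ 3\<bar> \<le> 3 * (cosh M * sinh M) * Q"
proof -
  define K where "K = cosh M * sinh M"
  let ?g = "\<lambda>\<theta>. (w \<theta> - w_mean)\<^sup>2 * (\<mu> \<theta> / w \<theta>)"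
  let ?h = "\<lambda>\<theta>. 3 * (w \<theta> - w_mean)\<^sup>2 * (- sinh (\<rho> \<theta>) * sin (\<beta> \<theta>) * \<mu> \<theta>)"
  have ftc: "(?h has_integral ((w b - w_mean) ^ 3 - (w a - w_mean) ^ 3)) {a..b}"
    using \<open>a \<le> b\<close>
    by (intro has_integral_DERIV) (auto intro!: derivative_eq_intros DERIV_w)
  have g_int: "?g integrable_on {x..y}" for x y
    using w_pos by (intro integrable_on_if_isCont continuous_intros isCont_w isCont_mu) (metis less_irrefl)
  then have Kg_int: "(\<lambda>\<theta>. 3 * K * ?g \<theta>) integrable_on {x..y}" for x y
    by (rule integrable_on_mult_right)
  have bound: "\<bar>?h \<theta>\<bar> \<le> 3 * K * ?g \<theta>" for \<theta>
  proof -
    have "M > 0"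
      using pos[of 0] max[of 0] by linarith
    have "w \<theta> \<le> cosh M"
      using w_le[of \<theta>] max[of \<theta>] pos[of \<theta>] by (smt (verit) cosh_real_nonneg_le_iff)
    then have "sinh M * w \<theta> \<le> K"
      using \<open>M > 0\<close> by (simp add: K_def mult.commute)
    have "sinh (\<rho> \<theta>) * \<bar>sin (\<beta> \<theta>)\<bar> \<le> sinh M * 1"
      using max[of \<theta>] sinh_rho_pos[of \<theta>] by (intro mult_mono) auto
    also have "\<dots> \<le> K / w \<theta>"
      using \<open>sinh M * w \<theta> \<le> K\<close> w_pos[of \<theta>] by (simp add: field_simps)
    finally have "sinh (\<rho> \<theta>) * \<bar>sin (\<beta> \<theta>)\<bar> \<le> K / w \<theta>" .
    then have "3 * (w \<theta> - w_mean)\<^sup>2 * \<mu> \<theta> * (sinh (\<rho> \<theta>) * \<bar>sin (\<beta> \<theta>)\<bar>) \<le>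
        3 * (w \<theta> - w_mean)\<^sup>2 * \<mu> \<theta> * (K / w \<theta>)"
      using mu_pos[of \<theta>] by (intro mult_left_mono) auto
    then show ?thesis
      using mu_pos[of \<theta>] sinh_rho_pos[of \<theta>] by (simp add: abs_mult mult_ac)
  qed
  have "\<bar>integral {a..b} ?h\<bar> \<le> integral {a..b} (\<lambda>\<theta>. 3 * K * ?g \<theta>)"
    unfolding real_norm_def[symmetric]
    by (rule integral_norm_bound_integral[OF has_integral_integrable[OF ftc] Kg_int])
      (simp only: real_norm_def bound)
  also have "\<dots> \<le> integral {0..2 * pi} (\<lambda>\<theta>. 3 * K * ?g \<theta>)"
  proof (rule integral_subset_le[OF _ Kg_int Kg_int])
    show "\<forall>\<theta>\<in>{0..2 * pi}. 0 \<le> 3 * K * ?g \<theta>"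
      using order_trans[OF abs_ge_zero bound] by blast
  qed (use assms(1-3) in auto)
  also have "\<dots> = 3 * K * Q"
    by (intro integral_unique has_integral_mult_right has_integral_variance)
  finally show ?thesis
    unfolding integral_unique[OF ftc] K_def .
qed

lemma cube_deviation_le:
  assumes "a \<in> {0..2 * pi}" "b \<in> {0..2 * pi}" "\<And>\<theta>. \<rho> \<theta> \<le> M"
  shows "(w b - w_mean) ^ 3 - (w a - w_mean) ^ 3 \<le> 3 * (cosh M * sinh M) * Q"
proof (cases "a \<le> b")
  case True
  then show ?thesis
    using cube_deviation_le_aux[of a b M, OF _ _ _ assms(3)] assms(1,2) by simp
next
  case False
  then show ?thesis
    using cube_deviation_le_aux[of b a M, OF _ _ _ assms(3)] assms(1,2) by simp
qed

lemma oscillation_le: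
  assumes \<theta>\<^sub>1: "\<theta>\<^sub>1 \<in> {0..2 * pi}" "\<forall>\<theta>. \<rho> \<theta>\<^sub>1 \<le> \<rho> \<theta>"
    and \<theta>\<^sub>2: "\<theta>\<^sub>2 \<in> {0..2 * pi}" "\<forall>\<theta>. \<rho> \<theta> \<le> \<rho> \<theta>\<^sub>2"
  shows "\<rho> \<theta>\<^sub>2 - \<rho> \<theta>\<^sub>1 \<le> exp (\<rho> \<theta>\<^sub>2) * (12 * (cosh (\<rho> \<theta>\<^sub>2) * sinh (\<rho> \<theta>\<^sub>2))) powr (1 / 3) * stab_fun Q"
proof -
  define m M D K where "m = \<rho> \<theta>\<^sub>1" and "M = \<rho> \<theta>\<^sub>2" and "D = exp (- m) - exp (- M)"
    and "K = cosh M * sinh M"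
  have "m \<le> M"
    unfolding m_def M_def using \<theta>\<^sub>2(2) by (rule spec)
  then have "D \<ge> 0"
    by (simp add: D_def)
  have "K \<ge> 0"
    using sinh_rho_pos[of \<theta>\<^sub>2] by (simp add: K_def M_def)
  have D: "(w \<theta>\<^sub>1 - w_mean) - (w \<theta>\<^sub>2 - w_mean) = D"
    using w_at_extremum[OF disjI2[OF \<theta>\<^sub>1(2)]] w_at_extremum[OF disjI1[OF \<theta>\<^sub>2(2)]]
    by (simp add: D_def m_def M_def)
  have "D ^ 3 \<le> 4 * ((w \<theta>\<^sub>1 - w_mean) ^ 3 - (w \<theta>\<^sub>2 - w_mean) ^ 3)"
    using diff_power3_le[of "w \<theta>\<^sub>2 - w_mean" "w \<theta>\<^sub>1 - w_mean"] D \<open>D \<ge> 0\<close> by simp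
  also have "\<dots> \<le> 4 * (3 * K * Q)"
    using cube_deviation_le[OF \<theta>\<^sub>2(1) \<theta>\<^sub>1(1) \<theta>\<^sub>2(2)[rule_format]] by (simp add: K_def M_def)
  finally have "D ^ 3 \<le> 12 * K * Q"
    by simp
  then have "(D ^ 3) powr (1 / 3) \<le> (12 * K * Q) powr (1 / 3)"
    using \<open>D \<ge> 0\<close> by (intro powr_mono2) auto
  moreover have "(D ^ 3) powr (1 / 3) = D"
    using \<open>D \<ge> 0\<close> by (cases "D = 0") (auto simp: powr_powr simp flip: powr_numeral)
  ultimately have "D \<le> (12 * K) powr (1 / 3) * Q powr (1 / 3)"
    using \<open>K \<ge> 0\<close> Q_nonneg by (simp add: powr_mult)
  also have "\<dots> \<le> (12 * K) powr (1 / 3) * stab_fun Q"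
    using Q_nonneg by (intro mult_left_mono powr_third_le_stab_fun) auto
  finally have D_le: "D \<le> (12 * K) powr (1 / 3) * stab_fun Q" .
  have "M - m \<le> exp M * D"
  proof -
    have "exp M * D = exp (M - m) - 1"
      by (simp add: D_def right_diff_distrib flip: exp_add)
    then show ?thesis
      using exp_ge_add_one_self[of "M - m"] by linarith
  qed
  also have "\<dots> \<le> exp M * ((12 * K) powr (1 / 3) * stab_fun Q)"
    using D_le by (intro mult_left_mono) auto
  finally show ?thesis
    by (simp add: m_def M_def K_def mult.assoc)
qed

end

text \<open>
  The circle has centre \<open>0\<close> and the maximum of \<open>\<rho>\<close> as its radius.
\<close>

theorem theorem1p5:
  shows "\<exists>C :: real \<Rightarrow> real \<Rightarrow> real \<Rightarrow> real \<Rightarrow> real.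
    \<forall>\<rho> :: real \<Rightarrow> real. radial_function \<rho> \<and> strictly_h_convex \<rho> \<longrightarrow>
      (\<exists>x R. R > 0 \<and>
        hausdorff_dist (graph_set \<rho>) (geodesic_circle x R)
        \<le> C (INF \<theta>. \<rho> \<theta>) (SUP \<theta>. \<rho> \<theta>) (SUP \<theta>. \<bar>deriv \<rho> \<theta>\<bar>) (INF \<theta>. curvature \<rho> \<theta>)
          * stab_fun (graph_int \<rho> (\<lambda>\<theta>. (Phi (\<rho> \<theta>) - support \<rho> \<theta>) * (curvature \<rho> \<theta> - 1))
              + (graph_length \<rho> - graph_area \<rho>)
              - 1 / (2 * pi) * (graph_length \<rho> - graph_area \<rho>)\<^sup>2))"
proof (intro exI[of _ "\<lambda>_ M _ _. exp M * (12 * (cosh M * sinh M)) powr (1 / 3)"] allI impI)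
  fix \<rho> :: "real \<Rightarrow> real"
  assume \<rho>: "radial_function \<rho> \<and> strictly_h_convex \<rho>"
  interpret h_convex_graph \<rho>
    using \<rho> by unfold_locales auto
  obtain \<theta>\<^sub>1 \<theta>\<^sub>2 where \<theta>: "\<theta>\<^sub>1 \<in> {0..2 * pi}" "\<theta>\<^sub>2 \<in> {0..2 * pi}"
      "\<forall>\<theta>. \<rho> \<theta>\<^sub>1 \<le> \<rho> \<theta>" "\<forall>\<theta>. \<rho> \<theta> \<le> \<rho> \<theta>\<^sub>2"
    by (rule obtain_extrema, rule that)
  have sup: "(SUP \<theta>. \<rho> \<theta>) = \<rho> \<theta>\<^sub>2"
    by (rule cSup_eq_maximum) (use \<theta>(4) in blast)+
  have "hausdorff_dist (graph_set \<rho>) (geodesic_circle 0 (\<rho> \<theta>\<^sub>2)) \<le> \<rho> \<theta>\<^sub>2 - \<rho> \<theta>\<^sub>1"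
  proof (intro hausdorff_dist_graph_circle_le pos)
    show "\<rho> \<theta>\<^sub>2 \<ge> 0"
      using pos[of \<theta>\<^sub>2] by simp
    show "\<bar>\<rho> \<theta> - \<rho> \<theta>\<^sub>2\<bar> \<le> \<rho> \<theta>\<^sub>2 - \<rho> \<theta>\<^sub>1" for \<theta>
      using spec[OF \<theta>(3), of \<theta>] spec[OF \<theta>(4), of \<theta>] by linarith
  qed
  also note oscillation_le[OF \<theta>(1,3,2,4)]
  finally have "hausdorff_dist (graph_set \<rho>) (geodesic_circle 0 (\<rho> \<theta>\<^sub>2))
      \<le> exp (SUP \<theta>. \<rho> \<theta>) * (12 * (cosh (SUP \<theta>. \<rho> \<theta>) * sinh (SUP \<theta>. \<rho> \<theta>))) powr (1 / 3) * stab_fun Q"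
    unfolding sup .
  then show "\<exists>x R. R > 0 \<and> hausdorff_dist (graph_set \<rho>) (geodesic_circle x R)
      \<le> exp (SUP \<theta>. \<rho> \<theta>) * (12 * (cosh (SUP \<theta>. \<rho> \<theta>) * sinh (SUP \<theta>. \<rho> \<theta>))) powr (1 / 3)
        * stab_fun (graph_int \<rho> (\<lambda>\<theta>. (Phi (\<rho> \<theta>) - support \<rho> \<theta>) * (curvature \<rho> \<theta> - 1))
            + (graph_length \<rho> - graph_area \<rho>)
            - 1 / (2 * pi) * (graph_length \<rho> - graph_area \<rho>)\<^sup>2)"
    unfolding Q_def using pos[of \<theta>\<^sub>2] by (intro exI[of _ "0 :: complex"] exI[of _ "\<rho> \<theta>\<^sub>2"] conjI)
qed

end
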